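(* Let $N\ge 1$ and let $F:[0,1]\times[0,1]\to\mathbb{R}$ be a continuously differentiable, strongly convex function. For $p,q\in[0,1]^2$ let $D_F(p,q)=F(p)-F(q)-\langle\nabla F(q),p-q\rangle$ be the Bregman divergence associated with $F$. Then the loss function $f_F:\{0,1\}^N\times(0,1)^N\to\mathbb{R}$ defined by $$f_F(\sigma,\theta)=\frac1N\sum_{i=1}^N D_F\big([\sigma_i,1-\sigma_i],[\theta_i,1-\theta_i]\big)$$ is linearly-decomposable.
   Context: A function $f:\{0,1\}^N\times(0,1)^N\to\mathbb{R}$ is called linearly-decomposable if there exist an invertible function $g:[0,1]\to\mathbb{R}$ (invertible meaning injective, i.e. invertible onto its image) and a function $h:[0,1]^N\to\mathbb{R}$ such that for all $\sigma\in\{0,1\}^N$ and $\theta\in(0,1)^N$, $$f(\sigma,\theta)=h(\theta)+\sum_{i=1}^N\sigma_i\,g(\theta_i).$$ Here $[a,b]$ inside $D_F$ denotes the vector in $\mathbb{R}^2$ with entries $a,b$. Continuous differentiability of $F$ is on the closed square, with one-sided derivatives on the boundary. *)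

theory Defs
  imports "HOL-Analysis.Analysis"
begin

text \<open>
  The plane is \<^typ>\<open>real \<times> real\<close> with its Euclidean inner product and norm. Functions whose
  informal domain is a set \<open>S\<close> are total here, and every notion below depends only on their values
  on \<open>S\<close>.
\<close>

abbreviation unit_square :: "(real \<times> real) set" where
  "unit_square \<equiv> {0..1} \<times> {0..1}"

text \<open>
  The gradient relative to \<open>S\<close>: at boundary points of \<open>S\<close> only increments staying in \<open>S\<close> are
  considered, so on the closed square its components are the (there one-sided) partial derivatives.
  It is meaningful only where the derivative relative to \<open>S\<close> exists and is unique; for the unit
  square see \<open>gradient_within_unit_square\<close> below.
\<close>

definition gradient_within :: "('a::real_inner \<Rightarrow> real) \<Rightarrow> 'a set \<Rightarrow> 'a \<Rightarrow> 'a" where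
  "gradient_within F S q = (THE G. (F has_derivative (\<lambda>v. G \<bullet> v)) (at q within S))"

definition continuously_differentiable_on :: "('a::real_inner \<Rightarrow> real) \<Rightarrow> 'a set \<Rightarrow> bool" where
  "continuously_differentiable_on F S \<longleftrightarrow>
     F differentiable_on S \<and> continuous_on S (gradient_within F S)"

definition strongly_convex_on :: "'a::real_inner set \<Rightarrow> ('a \<Rightarrow> real) \<Rightarrow> bool" where
  "strongly_convex_on S F \<longleftrightarrow> convex S \<and>
     (\<exists>m>0. \<forall>x\<in>S. \<forall>y\<in>S. \<forall>t\<in>{0..1}.
        F ((1 - t) *\<^sub>R x + t *\<^sub>R y)
          \<le> (1 - t) * F x + t * F y - m / 2 * t * (1 - t) * (norm (x - y))\<^sup>2)"

definition bregman :: "(real \<times> real \<Rightarrow> real) \<Rightarrow> real \<times> real \<Rightarrow> real \<times> real \<Rightarrow> real" where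
  "bregman F p q = F p - F q - gradient_within F unit_square q \<bullet> (p - q)"

text \<open>
  The number \<open>N \<ge> 1\<close> is \<^term>\<open>CARD('n)\<close>.
\<close>

definition bregman_loss ::
    "(real \<times> real \<Rightarrow> real) \<Rightarrow> real ^ 'n::finite \<Rightarrow> real ^ 'n \<Rightarrow> real" where
  "bregman_loss F \<sigma> \<theta> =
     1 / real CARD('n) * (\<Sum>i\<in>UNIV. bregman F (\<sigma> $ i, 1 - \<sigma> $ i) (\<theta> $ i, 1 - \<theta> $ i))"

definition linearly_decomposable :: "(real ^ 'n::finite \<Rightarrow> real ^ 'n \<Rightarrow> real) \<Rightarrow> bool" where
  "linearly_decomposable f \<longleftrightarrow>
     (\<exists>(g :: real \<Rightarrow> real) (h :: real ^ 'n \<Rightarrow> real). inj_on g {0..1} \<and>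
        (\<forall>\<sigma> \<theta>. (\<forall>i. \<sigma> $ i \<in> {0, 1}) \<longrightarrow> (\<forall>i. \<theta> $ i \<in> {0<..<1}) \<longrightarrow>
           f \<sigma> \<theta> = h \<theta> + (\<Sum>i\<in>UNIV. \<sigma> $ i * g (\<theta> $ i))))"

lemma gradient_within_unit_square:
  assumes "F differentiable_on unit_square" and q: "q \<in> unit_square"
  shows "(F has_derivative (\<lambda>v. gradient_within F unit_square q \<bullet> v)) (at q within unit_square)"
proof -
  have box: "unit_square = cbox (0, 0) (1, 1)"
    by (simp add: cbox_Pair_eq)
  obtain F' where F': "(F has_derivative F') (at q within unit_square)"
    using assms by (auto simp: differentiable_on_def differentiable_def)
  then interpret bounded_linear F'
    by (rule has_derivative_bounded_linear)
  have "F' v = adjoint F' 1 \<bullet> v" for v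
    using adjoint_works[OF linear_axioms, of v 1] by (simp add: inner_commute)
  then have "F' = (\<lambda>v. adjoint F' 1 \<bullet> v)"
    by blast
  then have "(F has_derivative (\<lambda>v. adjoint F' 1 \<bullet> v)) (at q within unit_square)"
    using F' by simp
  moreover have "G = H"
    if "(F has_derivative (\<lambda>v. G \<bullet> v)) (at q within unit_square)"
      "(F has_derivative (\<lambda>v. H \<bullet> v)) (at q within unit_square)" for G H
  proof -
    have "(\<lambda>v. G \<bullet> v) = (\<lambda>v. H \<bullet> v)"
      using that q unfolding box
      by (intro frechet_derivative_unique_within_closed_interval[of "(0, 0)" "(1, 1)" q F])
        (auto simp: Basis_prod_def)
    then show ?thesis
      by (metis vector_eq_rdot inner_commute)
  qed
  ultimately have "\<exists>!G. (F has_derivative (\<lambda>v. G \<bullet> v)) (at q within unit_square)"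
    by blast
  then show ?thesis
    unfolding gradient_within_def by (rule theI')
qed

end

theory Submission
  imports Defs
begin

text \<open>
  For a bit \<open>b\<close> the divergence from \<open>(b, 1 - b)\<close> to \<open>q = (t, 1 - t)\<close> takes only two values, hence is
  affine in \<open>b\<close>, with slope \<open>F (1, 0) - F (0, 1) - \<nabla>F(q) \<bullet> (1, -1)\<close>. The only non-constant part
  of the slope is the derivative of the restriction of \<open>F\<close> to the segment \<open>{(t, 1 - t)}\<close>, which is
  strictly monotone because \<open>F\<close> is strongly convex; so the slope is injective in \<open>t\<close>.
\<close>

text \<open>Strong convexity on the segment from \<open>x\<close> to \<open>y\<close> bounds the
  difference quotient at \<open>x\<close>. As \<open>t\<close> tends to 0 from the right, the
  quotient tends to \<open>D (y - x)\<close>, and the quadratic term leaves the positive gap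
  \<open>m / 2 * (norm (x - y))\<^sup>2\<close>, whence strictness.\<close>

lemma strongly_convex_on_imp_above_tangent:
  fixes F :: "'a::real_inner \<Rightarrow> real"
  assumes F: "strongly_convex_on S F"
    and D: "(F has_derivative D) (at x within S)"
    and xy: "x \<in> S" "y \<in> S" "x \<noteq> y"
  shows "F x + D (y - x) < F y"
proof -
  interpret D: bounded_linear D
    using D by (rule has_derivative_bounded_linear)
  obtain m where "convex S" and "m > 0" and m: "\<And>t. t \<in> {0..1} \<Longrightarrow>
      F ((1 - t) *\<^sub>R x + t *\<^sub>R y) \<le> (1 - t) * F x + t * F y - m / 2 * t * (1 - t) * (norm (x - y))\<^sup>2"
    using F xy unfolding strongly_convex_on_def by blast
  define p where "p t = x + t *\<^sub>R (y - x)" for t :: real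
  have p: "p t = (1 - t) *\<^sub>R x + t *\<^sub>R y" for t
    by (simp add: p_def algebra_simps)
  \<comment> \<open>Since \<open>D\<close> is a derivative relative to \<open>S\<close> only, the
    chain rule along \<open>p\<close> needs the segment to stay in \<open>S\<close>.\<close>
  have "p ` {0..1} \<subseteq> S"
    using \<open>convex S\<close> xy by (auto simp: p intro: convexD)
  then have D': "(F has_derivative D) (at (p 0) within p ` {0..1})"
    using D has_derivative_subset by (auto simp: p_def)
  have "(p has_derivative (\<lambda>t. t *\<^sub>R (y - x))) (at 0 within {0..1})"
    unfolding p_def by (auto intro!: derivative_eq_intros)
  then have "((\<lambda>t. F (p t)) has_derivative (\<lambda>t. D (t *\<^sub>R (y - x)))) (at 0 within {0..1})"
    using D' by (rule has_derivative_in_compose)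
  then have "((\<lambda>t. F (p t)) has_field_derivative D (y - x)) (at 0 within {0..1})"
    by (simp add: has_field_derivative_def D.scaleR mult_commute_abs)
  then have lim: "((\<lambda>t. (F (p t) - F x) / t) \<longlongrightarrow> D (y - x)) (at 0 within {0..1})"
    by (simp add: has_field_derivative_iff p_def)
  have "((\<lambda>t. F y - F x - m / 2 * (1 - t) * (norm (x - y))\<^sup>2) \<longlongrightarrow>
      F y - F x - m / 2 * (1 - 0) * (norm (x - y))\<^sup>2) (at 0 within {0..1})"
    by (intro tendsto_intros)
  moreover have "\<forall>\<^sub>F t in at 0 within {0..1}.
      (F (p t) - F x) / t \<le> F y - F x - m / 2 * (1 - t) * (norm (x - y))\<^sup>2"
    unfolding eventually_at_filter
  proof (intro always_eventually allI impI)
    fix t :: real assume "t \<noteq> 0" "t \<in> {0..1}"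
    then have "0 < t" by simp
    \<comment> \<open>Once \<open>F x\<close> is subtracted, every term of the strong convexity
      bound carries a factor \<open>t\<close>, which the division then removes.\<close>
    have "F (p t) - F x \<le> (F y - F x - m / 2 * (1 - t) * (norm (x - y))\<^sup>2) * t"
      using m[OF \<open>t \<in> {0..1}\<close>] by (simp only: p) (simp add: algebra_simps)
    with \<open>0 < t\<close> show "(F (p t) - F x) / t \<le> F y - F x - m / 2 * (1 - t) * (norm (x - y))\<^sup>2"
      by (simp only: pos_divide_le_eq)
  qed
  moreover have "at (0::real) within {0..1} \<noteq> bot"
    by (simp add: at_within_Icc_at_right)
  ultimately have "D (y - x) \<le> F y - F x - m / 2 * (norm (x - y))\<^sup>2"
    using tendsto_le lim by fastforce
  moreover have "0 < m / 2 * (norm (x - y))\<^sup>2"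
    using \<open>m > 0\<close> \<open>x \<noteq> y\<close> by simp
  ultimately show ?thesis by linarith
qed

text \<open>The endpoints 0 and 1 correspond to the corners (0, 1) and (1, 0) of the square. The
  gradient relative to the square suffices there, as the antidiagonal stays inside it.\<close>

lemma inj_on_gradient_within_antidiagonal:
  assumes diff: "F differentiable_on unit_square"
    and F: "strongly_convex_on unit_square F"
  shows "inj_on (\<lambda>t. gradient_within F unit_square (t, 1 - t) \<bullet> (1, -1)) {0..1}"
proof (rule inj_onI, rule ccontr)
  define G where "G t = gradient_within F unit_square (t, 1 - t)" for t
  fix s t :: real
  assume st: "s \<in> {0..1}" "t \<in> {0..1}" "s \<noteq> t"
    and "gradient_within F unit_square (s, 1 - s) \<bullet> (1, -1) =
      gradient_within F unit_square (t, 1 - t) \<bullet> (1, -1)"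
  then have eq: "G s \<bullet> (1, -1) = G t \<bullet> (1, -1)"
    by (simp add: G_def)
  have tangent: "F (a, 1 - a) + (b - a) * (G a \<bullet> (1, -1)) < F (b, 1 - b)"
    if "a \<in> {0..1}" "b \<in> {0..1}" "a \<noteq> b" for a b
  proof -
    have "(b, 1 - b) - (a, 1 - a) = (b - a) *\<^sub>R (1, -1)"
      by simp
    then have "G a \<bullet> ((b, 1 - b) - (a, 1 - a)) = (b - a) * (G a \<bullet> (1, -1))"
      by (simp only: inner_scaleR_right)
    moreover have "F (a, 1 - a) + G a \<bullet> ((b, 1 - b) - (a, 1 - a)) < F (b, 1 - b)"
      unfolding G_def using that
      by (intro strongly_convex_on_imp_above_tangent[OF F]
          gradient_within_unit_square[OF diff]) auto
    ultimately show ?thesis by simp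
  qed
  \<comment> \<open>Add the tangent inequalities from \<open>s\<close> to \<open>t\<close> and from
    \<open>t\<close> to \<open>s\<close>: with equal slopes the linear terms cancel, leaving a
    number strictly below itself.\<close>
  show False
    using tangent[OF st] tangent[OF st(2,1)] st(3) eq by (simp add: algebra_simps)
qed

lemma bregman_bit:
  assumes "b \<in> {0, 1}"
  shows "bregman F (b, 1 - b) q =
    bregman F (0, 1) q + b * (F (1, 0) - F (0, 1) - gradient_within F unit_square q \<bullet> (1, -1))"
  using assms by (cases q; cases "gradient_within F unit_square q")
    (auto simp: bregman_def algebra_simps)

theorem lemma1:
  fixes F :: "real \<times> real \<Rightarrow> real"
  assumes "continuously_differentiable_on F unit_square"
    and "strongly_convex_on unit_square F"
  shows "linearly_decomposable (bregman_loss F :: real ^ 'n::finite \<Rightarrow> real ^ 'n \<Rightarrow> real)"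
proof -
  define c where "c = 1 / real CARD('n)"
  have "c \<noteq> 0"
    by (simp add: c_def)
  \<comment> \<open>The slope in \<open>bregman_bit\<close> absorbs the weight 1/N; as
    \<open>c \<noteq> 0\<close>, it stays injective.\<close>
  define g where "g t =
    c * (F (1, 0) - F (0, 1) - gradient_within F unit_square (t, 1 - t) \<bullet> (1, -1))" for t
  \<comment> \<open>The decomposition forces this choice: at the all-zero bit vector the sum
    vanishes, so \<open>h \<theta>\<close> is the loss there.\<close>
  define h where "h \<theta> = c * (\<Sum>i\<in>UNIV. bregman F (0, 1) (\<theta> $ i, 1 - \<theta> $ i))"
    for \<theta> :: "real ^ 'n"
  have "F differentiable_on unit_square"
    using assms(1) by (simp add: continuously_differentiable_on_def)
  then have "inj_on g {0..1}"
    using inj_on_gradient_within_antidiagonal[OF _ assms(2)] \<open>c \<noteq> 0\<close>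
    by (simp add: g_def inj_on_def)
  moreover have "bregman_loss F \<sigma> \<theta> = h \<theta> + (\<Sum>i\<in>UNIV. \<sigma> $ i * g (\<theta> $ i))"
    if "\<forall>i. \<sigma> $ i \<in> {0, 1}" for \<sigma> \<theta> :: "real ^ 'n"
  proof -
    have "bregman_loss F \<sigma> \<theta> = (\<Sum>i\<in>UNIV. c * bregman F (\<sigma> $ i, 1 - \<sigma> $ i) (\<theta> $ i, 1 - \<theta> $ i))"
      by (simp add: bregman_loss_def c_def sum_distrib_left)
    also have "\<dots> = (\<Sum>i\<in>UNIV. c * bregman F (0, 1) (\<theta> $ i, 1 - \<theta> $ i) + \<sigma> $ i * g (\<theta> $ i))"
      by (intro sum.cong refl, subst bregman_bit)
        (use that in \<open>auto simp only: g_def distrib_left mult.left_commute\<close>)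
    also have "\<dots> = h \<theta> + (\<Sum>i\<in>UNIV. \<sigma> $ i * g (\<theta> $ i))"
      by (simp add: h_def sum.distrib sum_distrib_left)
    finally show ?thesis .
  qed
  ultimately show ?thesis
    unfolding linearly_decomposable_def by blast
qed

end
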